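(* Let $n$ be a positive integer and let $a,b\in\mathbb{Z}_n^{*}$. If the cyclic subgroup $\langle b\rangle$ of $\mathbb{Z}_n^{*}$ is a subgroup of $\langle a\rangle$, then $\mathbb{I}_n(a)\subseteq\mathbb{I}_n(b)$.
   Context: $\mathbb{Z}_2^{n}$ denotes the group $\{+1,-1\}^n$ of binary sequences $Y=(y_0,\dots,y_{n-1})$ under componentwise multiplication, with indices read modulo $n$. $\mathbb{Z}_n^{*}$ is the group of units modulo $n$. For $a\in\mathbb{Z}_n^{*}$, the decimation $\delta_a$ acts on $\mathbb{Z}_2^{n}$ by $(\delta_a Y)_i=y_{ai \bmod n}$. Define $\mathbb{I}_n(a)=\{Y\in\mathbb{Z}_2^{n}:\delta_a Y=Y\}$. *)

theory Defs
  imports "HOL-Number_Theory.Residues" "HOL-Algebra.Product_Groups" "HOL-Algebra.Sym_Groups"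
begin

text \<open>
  \<^const>\<open>residue_ring\<close> has unit element \<open>1\<close> rather than \<open>1 mod n\<close>. For \<open>n = 1\<close> this is not an
  element of the carrier \<open>{0}\<close>, and the ring would have no units; normalising the unit element
  makes the unit group of the zero ring the trivial group and changes nothing for \<open>n > 1\<close>.
\<close>

definition unit_group_mod :: "nat \<Rightarrow> int monoid" where
  "unit_group_mod n = units_of ((residue_ring (int n))\<lparr>one := 1 mod int n\<rparr>)"

text \<open>
  \<^const>\<open>sign_img\<close> is the multiplicative group \<open>{-1, 1}\<close>. The indices \<open>0, \<dots>, n - 1\<close> are the
  elements of \<^term>\<open>residue_ring (int n)\<close>; a sequence is an extensional function on them.
\<close>

definition binary_seq_group :: "nat \<Rightarrow> (int \<Rightarrow> int) monoid" where
  "binary_seq_group n = product_group {0..<int n} (\<lambda>_. sign_img)"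

definition decimation :: "nat \<Rightarrow> int \<Rightarrow> (int \<Rightarrow> int) \<Rightarrow> (int \<Rightarrow> int)" where
  "decimation n a Y = (\<lambda>i\<in>{0..<int n}. Y (a * i mod int n))"

definition decimation_invariants :: "nat \<Rightarrow> int \<Rightarrow> (int \<Rightarrow> int) set" where
  "decimation_invariants n a = {Y \<in> carrier (binary_seq_group n). decimation n a Y = Y}"

lemma unit_group_mod_eq:
  assumes "n > 1"
  shows "unit_group_mod n = units_of (residue_ring (int n))"
  using assms by (simp add: unit_group_mod_def residue_ring_def)

lemma comm_group_unit_group_mod:
  assumes "n > 0"
  shows "comm_group (unit_group_mod n)"
proof -
  let ?R = "(residue_ring (int n))\<lparr>one := 1 mod int n\<rparr>"
  have [simp]: "1 + k mod int n \<le> int n" for k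
    using pos_mod_bound[of "int n" k] assms by linarith
  have "comm_monoid ?R"
    by (rule comm_monoidI)
      (use assms in \<open>auto simp: residue_ring_def mod_simps algebra_simps\<close>)
  then show ?thesis
    unfolding unit_group_mod_def by (rule comm_monoid.units_comm_group)
qed

lemma carrier_unit_group_mod:
  assumes "n > 0"
  shows "carrier (unit_group_mod n) = {a \<in> {0..<int n}. coprime a (int n)}"
proof (cases "n = 1")
  case True
  then show ?thesis
    by (auto simp: unit_group_mod_def units_of_def Units_def residue_ring_def)
next
  case False
  with assms interpret residues "int n" "residue_ring (int n)"
    by unfold_locales auto
  from False assms show ?thesis
    by (auto simp: unit_group_mod_eq units_of_carrier res_units_eq order.order_iff_strict)
qed

lemma carrier_binary_seq_group:
  "carrier (binary_seq_group n) = {0..<int n} \<rightarrow>\<^sub>E {-1, 1}"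
  by (simp add: binary_seq_group_def product_group_def sign_img_def)

end

(* For fixed Y, the units c with \<delta>\<^sub>c Y = Y form a subgroup of the unit group (a stabiliser).
   If it contains a, it contains everything generated by a, in particular b. *)
theory Submission
  imports Defs
begin

text \<open>The units act on sequences by decimation, and membership of Y in the invariants of c
  says that c stabilises Y. Stabilisers are subgroups
  (\<open>subgroup_decimation_stabiliser\<close>), so one containing a contains the group generated
  by a, hence the group generated by b, hence b.\<close>

lemma mult_unit_group_mod:
  "x \<otimes>\<^bsub>unit_group_mod n\<^esub> y = x * y mod int n"
  by (simp add: unit_group_mod_def units_of_def residue_ring_def)

lemma one_unit_group_mod: "\<one>\<^bsub>unit_group_mod n\<^esub> = 1 mod int n"
  by (simp add: unit_group_mod_def units_of_def)

text \<open>Off the index range both \<open>decimation n c Y\<close> and the extensional Y are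
  \<open>undefined\<close>, so equality of functions reduces to the indices in range.\<close>

lemma decimation_invariants_iff:
  "Y \<in> decimation_invariants n c \<longleftrightarrow>
    Y \<in> carrier (binary_seq_group n) \<and> (\<forall>i\<in>{0..<int n}. Y (c * i mod int n) = Y i)"
proof -
  have "decimation n c Y = Y \<longleftrightarrow> (\<forall>i\<in>{0..<int n}. Y (c * i mod int n) = Y i)"
    if "Y \<in> carrier (binary_seq_group n)"
  proof -
    have "Y \<in> extensional {0..<int n}"
      using that by (simp add: carrier_binary_seq_group PiE_def)
    then show ?thesis
      unfolding decimation_def by (auto simp: fun_eq_iff restrict_def extensional_def)
  qed
  then show ?thesis
    by (auto simp: decimation_invariants_def)
qed

lemma subgroup_decimation_stabiliser:
  assumes "n > 0" and Y: "Y \<in> carrier (binary_seq_group n)"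
  shows "subgroup {c \<in> carrier (unit_group_mod n). Y \<in> decimation_invariants n c}
           (unit_group_mod n)"
proof -
  interpret comm_group "unit_group_mod n"
    using assms(1) by (rule comm_group_unit_group_mod)
  have inv: "Y \<in> decimation_invariants n (inv\<^bsub>unit_group_mod n\<^esub> c)"
    if c: "c \<in> carrier (unit_group_mod n)" and Yc: "Y \<in> decimation_invariants n c" for c
  proof -
    let ?d = "inv\<^bsub>unit_group_mod n\<^esub> c"
    \<comment> \<open>The unit stays in the form \<open>1 mod int n\<close>, which is 0 when n =
      1.\<close>
    have cd: "c * ?d mod int n = 1 mod int n"
      using r_inv[OF c] by (simp add: mult_unit_group_mod one_unit_group_mod)
    have "Y (?d * i mod int n) = Y i" if i: "i \<in> {0..<int n}" for i
    proof -
      \<comment> \<open>Invariance under c is used at the index \<open>?d * i mod int n\<close>,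
        which multiplication by c sends back to i.\<close>
      have "c * (?d * i mod int n) mod int n = (c * ?d mod int n) * i mod int n"
        by (simp add: mod_simps mult.assoc)
      also have "\<dots> = i"
        using i by (simp add: cd mod_simps)
      finally show ?thesis
        using Yc i assms(1) unfolding decimation_invariants_iff
        by (metis atLeastLessThan_iff of_nat_0_less_iff pos_mod_bound pos_mod_sign)
    qed
    then show ?thesis
      using Y by (simp add: decimation_invariants_iff)
  qed
  have mult: "Y \<in> decimation_invariants n (c * d mod int n)"
    if "Y \<in> decimation_invariants n c" "Y \<in> decimation_invariants n d" for c d
  proof -
    have "Y ((c * d mod int n) * i mod int n) = Y i" if "i \<in> {0..<int n}" for i
    proof -
      \<comment> \<open>Invariance under c, used at the reduced index
        \<open>d * i mod int n\<close>, removes c; invariance under d at i then removes d.\<close>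
      have "(c * d mod int n) * i mod int n = c * (d * i mod int n) mod int n"
        by (simp add: mod_simps mult.assoc)
      moreover have "d * i mod int n \<in> {0..<int n}"
        using assms(1) by simp
      ultimately show ?thesis
        using \<open>Y \<in> decimation_invariants n c\<close> \<open>Y \<in> decimation_invariants n d\<close> that
        by (simp add: decimation_invariants_iff)
    qed
    then show ?thesis
      using Y by (simp add: decimation_invariants_iff)
  qed
  show ?thesis
  proof (rule subgroupI)
    have "Y \<in> decimation_invariants n \<one>\<^bsub>unit_group_mod n\<^esub>"
      using Y by (simp add: decimation_invariants_iff one_unit_group_mod mod_simps)
    then show "{c \<in> carrier (unit_group_mod n). Y \<in> decimation_invariants n c} \<noteq> {}"
      using one_closed by blast
  next
    fix c d
    assume "c \<in> {c \<in> carrier (unit_group_mod n). Y \<in> decimation_invariants n c}"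
      and "d \<in> {c \<in> carrier (unit_group_mod n). Y \<in> decimation_invariants n c}"
    then show "c \<otimes>\<^bsub>unit_group_mod n\<^esub> d
        \<in> {c \<in> carrier (unit_group_mod n). Y \<in> decimation_invariants n c}"
      using mult m_closed[of c d] by (simp add: mult_unit_group_mod)
  qed (use inv in auto)
qed

theorem theorem1:
  fixes n :: nat and a b :: int
  assumes "n > 0"
    and "a \<in> carrier (unit_group_mod n)"
    and "b \<in> carrier (unit_group_mod n)"
    and "subgroup (carrier (subgroup_generated (unit_group_mod n) {b}))
           (subgroup_generated (unit_group_mod n) {a})"
  shows "decimation_invariants n a \<subseteq> decimation_invariants n b"
proof
  fix Y assume Ya: "Y \<in> decimation_invariants n a"
  let ?S = "{c \<in> carrier (unit_group_mod n). Y \<in> decimation_invariants n c}"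
  interpret comm_group "unit_group_mod n"
    using assms(1) by (rule comm_group_unit_group_mod)
  have "subgroup ?S (unit_group_mod n)"
    using assms(1) Ya by (intro subgroup_decimation_stabiliser) (auto simp: decimation_invariants_iff)
  then have "generate (unit_group_mod n) {a} \<subseteq> ?S"
    using Ya assms(2) by (intro generate_subgroup_incl) auto
  moreover have "b \<in> generate (unit_group_mod n) {b}"
    by (simp add: generate.incl)
  \<comment> \<open>The carrier of \<open>subgroup_generated\<close> is generated by the
    intersection of the given set with the group's carrier; as a and b are units, the intersections
    are the singletons themselves.\<close>
  moreover have "generate (unit_group_mod n) {b} \<subseteq> generate (unit_group_mod n) {a}"
    using subgroup.subset[OF assms(4)] assms(2,3)
    by (simp add: carrier_subgroup_generated)
  ultimately show "Y \<in> decimation_invariants n b"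
    by auto
qed

end
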